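(* For every integer $m>3$, the Graver complexity $g(m):=g\left((1,1,1)^{(m)}\right)$ of the matrix $(1,1,1)^{(m)}$ satisfies $g(m)\geq 17\cdot 2^{m-3}-7$.
   Context: For an $s\times t$ integer matrix $A$ and a positive integer $n$, the $n$-fold product of $A$ is the $(t+ns)\times nt$ matrix $A^{(n)}:=({\bf 1}_n\otimes I_t)\oplus(I_n\otimes A)$, i.e. the block matrix whose first block row is $(I_t, I_t,\dots,I_t)$ ($n$ copies of the $t\times t$ identity) followed by the block-diagonal matrix with $n$ diagonal copies of $A$. In particular $(1,1,1)^{(m)}$ is the $m$-fold product of the $1\times 3$ matrix $(1,1,1)$, which is the $(3+m)\times 3m$ vertex-edge incidence matrix of the complete bipartite graph $K_{3,m}$. On $\mathbb{Z}^N$ define the partial order $u\sqsubseteq v$ iff $|u_i|\le|v_i|$ and $u_iv_i\ge 0$ for all $i$. The Graver basis $\mathcal{G}(B)$ of an integer matrix $B$ with $N$ columns is the (finite) set of $\sqsubseteq$-minimal elements of $\{x\in\mathbb{Z}^N: Bx=0,\ x\neq 0\}$. For an $s\times t$ integer matrix $A$ and $x\in\mathbb{Z}^{nt}$ written in blocks $x=(x^1,\dots,x^n)$ with $x^i\in\mathbb{Z}^t$, the type of $x$ is the number of indices $i$ with $x^i\neq 0$. The Graver complexity of $A$ is $g(A):=\sup\left(\{0\}\cup\{\mathrm{type}(x): x\in\bigcup_{n\ge1}\mathcal{G}(A^{(n)})\}\right)$. *)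

theory Defs
  imports
    "Jordan_Normal_Form.Matrix_Kernel"
    "HOL-Library.Extended_Nat"
begin

definition kronecker :: "'a :: semiring_0 mat \<Rightarrow> 'a mat \<Rightarrow> 'a mat" (infixl \<open>\<otimes>\<^sub>k\<close> 70) where
  "A \<otimes>\<^sub>k B = mat (dim_row A * dim_row B) (dim_col A * dim_col B)
     (\<lambda>(i, j). A $$ (i div dim_row B, j div dim_col B) * B $$ (i mod dim_row B, j mod dim_col B))"

text \<open>The \<open>n\<close>-fold product \<open>(1\<^sub>n \<otimes> I\<^sub>t) \<oplus> (I\<^sub>n \<otimes> A)\<close>, where \<open>1\<^sub>n\<close> is the all-ones row vector
  of length \<open>n\<close> and \<open>\<oplus>\<close> stacks its first argument on top of its second.\<close>

definition nfold :: "int mat \<Rightarrow> nat \<Rightarrow> int mat" where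
  "nfold A n = (mat 1 n (\<lambda>_. 1) \<otimes>\<^sub>k 1\<^sub>m (dim_col A)) @\<^sub>r (1\<^sub>m n \<otimes>\<^sub>k A)"

lemma nfold_carrier:
  assumes "A \<in> carrier_mat s t"
  shows "nfold A n \<in> carrier_mat (t + n * s) (n * t)"
  using assms by (auto simp: nfold_def kronecker_def)

lemma nfold_index:
  assumes A: "A \<in> carrier_mat s t" and i: "i < t + n * s" and j: "j < n * t"
  shows "nfold A n $$ (i, j) =
    (if i < t then (if j mod t = i then 1 else 0)
     else if (i - t) div s = j div t then A $$ ((i - t) mod s, j mod t) else 0)"
proof -
  have t: "t > 0" using j by (cases t) auto
  have jt: "j div t < n" using j t by (simp add: less_mult_imp_div_less)
  have jm: "j mod t < t" using t by simp
  have id: "(i - t) div s < n" if "\<not> i < t"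
    using that i by (simp add: less_mult_imp_div_less)
  have lt: "i - t < n * s" if "\<not> i < t" using that i by simp
  show ?thesis
    using A i j t jt jm id lt
    by (auto simp: nfold_def kronecker_def append_rows_def)
qed

definition conformal :: "int vec \<Rightarrow> int vec \<Rightarrow> bool" (infix \<open>\<sqsubseteq>\<^sub>c\<close> 50) where
  "u \<sqsubseteq>\<^sub>c v \<longleftrightarrow> dim_vec u = dim_vec v \<and>
     (\<forall>i < dim_vec u. \<bar>u $ i\<bar> \<le> \<bar>v $ i\<bar> \<and> u $ i * v $ i \<ge> 0)"

definition graver_basis :: "int mat \<Rightarrow> int vec set" where
  "graver_basis B = {x \<in> mat_kernel B - {0\<^sub>v (dim_col B)}.
     \<forall>y \<in> mat_kernel B - {0\<^sub>v (dim_col B)}. y \<sqsubseteq>\<^sub>c x \<longrightarrow> y = x}"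

text \<open>Blocks are numbered from \<open>0\<close>; each has length \<open>t\<close>.\<close>

definition vec_block :: "nat \<Rightarrow> int vec \<Rightarrow> nat \<Rightarrow> int vec" where
  "vec_block t x i = vec t (\<lambda>j. x $ (i * t + j))"

definition vec_type :: "nat \<Rightarrow> nat \<Rightarrow> int vec \<Rightarrow> nat" where
  "vec_type t n x = card {i. i < n \<and> vec_block t x i \<noteq> 0\<^sub>v t}"

text \<open>The supremum is taken in \<^typ>\<open>enat\<close>, so no finiteness is presupposed.\<close>

definition graver_complexity :: "int mat \<Rightarrow> enat" where
  "graver_complexity A =
     Sup ({0} \<union> {enat (vec_type (dim_col A) n x) | n x. n \<ge> 1 \<and> x \<in> graver_basis (nfold A n)})"

definition row_111 :: "int mat" where
  "row_111 = mat_of_rows_list 3 [[1, 1, 1]]"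

end

theory Submission
  imports Defs
begin

text \<open>If elements \<open>C\<^sub>i\<close> of the Graver basis of \<open>A\<close> satisfy a relation \<open>\<Sum> h\<^sub>i C\<^sub>i = 0\<close> with positive
  integers \<open>h\<^sub>i\<close>, and every integer relation between them is an integer multiple of it, then
  stacking \<open>h\<^sub>i\<close> copies of each \<open>C\<^sub>i\<close> gives an element of the Graver basis of an \<open>n\<close>-fold product,
  of type \<open>\<Sum> h\<^sub>i\<close>. For \<open>A = (1,1,1)\<^sup>(\<^sup>m\<^sup>)\<close> the \<open>C\<^sub>i\<close> are hexagons in \<open>K\<^sub>3\<^sub>,\<^sub>m\<close>. Seven hexagons with
  weights \<open>1, 2, 3, 3, 5, 6, 7\<close> settle \<open>m = 4\<close>. In the step from \<open>m\<close> to \<open>m + 1\<close> the three hexagons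
  arising from the last hexagon by replacing one of its columns by the new column add up to twice
  that hexagon; giving weight \<open>7\<close> to each of them and doubling all the other weights
  turns a total weight \<open>S\<close> into \<open>2 S + 7\<close>. The new column forces equal coefficients on the
  three in every relation, and since \<open>7\<close> is odd the relation stays primitive.\<close>

section \<open>Sums over blocks and over fibres\<close>

lemma sum_lessThan_mult:
  fixes f :: "nat \<Rightarrow> 'a :: comm_monoid_add"
  shows "(\<Sum>c<n * t. f c) = (\<Sum>l<n. \<Sum>j<t. f (l * t + j))"
proof -
  have "sum f {l * t..<l * t + t} = (\<Sum>j<t. f (l * t + j))" for l
    using sum.shift_bounds_nat_ivl[of f 0 "l * t" t]
    by (simp add: add.commute lessThan_atLeast0)
  then show ?thesis by (simp add: sum.nat_group[symmetric])
qed

lemma sum_fibers: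
  fixes F :: "nat \<Rightarrow> 'a :: comm_semiring_1"
  assumes "finite S" "\<sigma> ` S \<subseteq> {..<k}"
  shows "(\<Sum>l\<in>S. F (\<sigma> l)) = (\<Sum>i<k. of_nat (card {l \<in> S. \<sigma> l = i}) * F i)"
proof -
  have "(\<Sum>l\<in>S. F (\<sigma> l)) = (\<Sum>i<k. \<Sum>l\<in>{l \<in> S. \<sigma> l = i}. F (\<sigma> l))"
    using assms by (intro sum.group[symmetric]) auto
  also have "\<dots> = (\<Sum>i<k. of_nat (card {l \<in> S. \<sigma> l = i}) * F i)"
    by (intro sum.cong) auto
  finally show ?thesis .
qed

text \<open>Serves to line up \<open>h i\<close> copies of the i-th block, in some order. A
  bijection onto the disjoint union of sets of sizes \<open>h i\<close>, followed by the first
  projection, does it.\<close>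

lemma obtain_with_fiber_cards:
  fixes h :: "nat \<Rightarrow> nat"
  obtains \<sigma> :: "nat \<Rightarrow> nat" where
    "\<And>l. l < (\<Sum>i<k. h i) \<Longrightarrow> \<sigma> l < k"
    "\<And>i. i < k \<Longrightarrow> card {l \<in> {..<\<Sum>i<k. h i}. \<sigma> l = i} = h i"
proof -
  let ?S = "SIGMA i:{..<k}. {..<h i}" and ?N = "\<Sum>i<k. h i"
  have "card ?S = ?N" by simp
  then obtain f where f: "bij_betw f {..<?N} ?S"
    using finite_same_card_bij[of "{..<?N}" ?S] by auto
  show ?thesis
  proof
    fix l assume "l < ?N"
    then have "f l \<in> ?S" using f by (auto simp: bij_betw_def)
    then show "fst (f l) < k" by auto
  next
    fix i assume i: "i < k"
    have "f ` {l \<in> {..<?N}. fst (f l) = i} = {i} \<times> {..<h i}"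
    proof (intro equalityI subsetI)
      fix z assume "z \<in> f ` {l \<in> {..<?N}. fst (f l) = i}"
      then obtain l where l: "l < ?N" "fst (f l) = i" "z = f l" by auto
      then have "z \<in> ?S" using f by (auto simp: bij_betw_def)
      with l show "z \<in> {i} \<times> {..<h i}" by auto
    next
      fix z assume z: "z \<in> {i} \<times> {..<h i}"
      then have "z \<in> f ` {..<?N}" using f i by (auto simp: bij_betw_def)
      then obtain l where "l < ?N" "z = f l" by auto
      moreover have "fst z = i" using z by auto
      ultimately show "z \<in> f ` {l \<in> {..<?N}. fst (f l) = i}" by auto
    qed
    moreover have "inj_on f {l \<in> {..<?N}. fst (f l) = i}"
      using bij_betw_imp_inj_on[OF f] by (rule inj_on_subset) auto
    ultimately have "card ({i} \<times> {..<h i}) = card {l \<in> {..<?N}. fst (f l) = i}"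
      using card_image[of f "{l \<in> {..<?N}. fst (f l) = i}"] by (simp only:)
    then show "card {l \<in> {..<?N}. fst (f l) = i} = h i" by simp
  qed
qed

section \<open>The kernel of an n-fold product\<close>

lemma block_index_less: "l * t + j < n * t" if "l < n" "j < t" for n t :: nat
proof -
  have "l * t + j < Suc l * t" using that by simp
  also have "\<dots> \<le> n * t" using that by (intro mult_le_mono1) simp
  finally show ?thesis .
qed

lemma mult_mat_vec_index_sum:
  assumes "A \<in> carrier_mat s t" "x \<in> carrier_vec t" "i < s"
  shows "(A *\<^sub>v x) $ i = (\<Sum>j<t. A $$ (i, j) * x $ j)"
  using assms by (simp add: scalar_prod_def lessThan_atLeast0)

lemma nfold_mult_index_top:
  assumes A: "A \<in> carrier_mat s t" and x: "x \<in> carrier_vec (n * t)" and i: "i < t"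
  shows "(nfold A n *\<^sub>v x) $ i = (\<Sum>l<n. x $ (l * t + i))"
proof -
  have "(nfold A n *\<^sub>v x) $ i = (\<Sum>c<n * t. nfold A n $$ (i, c) * x $ c)"
    using x i by (intro mult_mat_vec_index_sum[OF nfold_carrier[OF A]]) auto
  also have "\<dots> = (\<Sum>l<n. \<Sum>j<t. nfold A n $$ (i, l * t + j) * x $ (l * t + j))"
    by (rule sum_lessThan_mult)
  also have "\<dots> = (\<Sum>l<n. \<Sum>j<t. if j = i then x $ (l * t + j) else 0)"
    using A i by (intro sum.cong refl) (auto simp: nfold_index[OF A] block_index_less)
  also have "\<dots> = (\<Sum>l<n. x $ (l * t + i))"
    using i by simp
  finally show ?thesis .
qed

lemma nfold_mult_index_block:
  assumes A: "A \<in> carrier_mat s t" and x: "x \<in> carrier_vec (n * t)" and l: "l < n" and i: "i < s"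
  shows "(nfold A n *\<^sub>v x) $ (t + l * s + i) = (A *\<^sub>v vec_block t x l) $ i"
proof -
  have b: "t + l * s + i < t + n * s"
    using block_index_less[OF l i] by simp
  have "(nfold A n *\<^sub>v x) $ (t + l * s + i) = (\<Sum>c<n * t. nfold A n $$ (t + l * s + i, c) * x $ c)"
    using x b by (intro mult_mat_vec_index_sum[OF nfold_carrier[OF A]]) auto
  also have "\<dots> = (\<Sum>l'<n. \<Sum>j<t. nfold A n $$ (t + l * s + i, l' * t + j) * x $ (l' * t + j))"
    by (rule sum_lessThan_mult)
  also have "\<dots> = (\<Sum>l'<n. if l' = l then \<Sum>j<t. A $$ (i, j) * x $ (l * t + j) else 0)"
    using i b by (intro sum.cong refl) (auto simp: nfold_index[OF A] block_index_less
        intro!: sum.cong sum.neutral)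
  also have "\<dots> = (\<Sum>j<t. A $$ (i, j) * x $ (l * t + j))"
    using l by simp
  also have "\<dots> = (A *\<^sub>v vec_block t x l) $ i"
    using A i by (subst mult_mat_vec_index_sum[of _ s t]) (auto simp: vec_block_def)
  finally show ?thesis .
qed

text \<open>Each top row picks one and the same coordinate out of every block, and each diagonal
  copy of \<open>A\<close> sees a single block.\<close>

lemma mat_kernel_nfold_iff:
  assumes A: "A \<in> carrier_mat s t"
  shows "x \<in> mat_kernel (nfold A n) \<longleftrightarrow> x \<in> carrier_vec (n * t) \<and>
    (\<forall>j<t. (\<Sum>l<n. x $ (l * t + j)) = 0) \<and> (\<forall>l<n. vec_block t x l \<in> mat_kernel A)"
    (is "?L \<longleftrightarrow> ?R")
proof
  assume ?L
  then have x: "x \<in> carrier_vec (n * t)" and z: "nfold A n *\<^sub>v x = 0\<^sub>v (t + n * s)"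
    using mat_kernelD[OF nfold_carrier[OF A]] by auto
  have "(\<Sum>l<n. x $ (l * t + j)) = 0" if "j < t" for j
    using nfold_mult_index_top[OF A x that] z that by simp
  moreover have "vec_block t x l \<in> mat_kernel A" if l: "l < n" for l
  proof (rule mat_kernelI[OF A])
    show "A *\<^sub>v vec_block t x l = 0\<^sub>v s"
    proof (rule eq_vecI)
      fix i assume "i < dim_vec (0\<^sub>v s :: int vec)"
      then have i: "i < s" by simp
      show "(A *\<^sub>v vec_block t x l) $ i = 0\<^sub>v s $ i"
        using nfold_mult_index_block[OF A x l i] z block_index_less[OF l i] i by simp
    qed (use A in simp)
  qed (simp add: vec_block_def)
  ultimately show ?R using x by blast
next
  assume R: ?R
  then have x: "x \<in> carrier_vec (n * t)" by blast
  show ?L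
  proof (rule mat_kernelI[OF nfold_carrier[OF A] x], rule eq_vecI)
    fix c assume "c < dim_vec (0\<^sub>v (t + n * s) :: int vec)"
    then have c: "c < t + n * s" by simp
    show "(nfold A n *\<^sub>v x) $ c = 0\<^sub>v (t + n * s) $ c"
    proof (cases "c < t")
      case True
      then show ?thesis using nfold_mult_index_top[OF A x True] R by simp
    next
      case False
      define l i where "l = (c - t) div s" and "i = (c - t) mod s"
      have "s > 0" using c False by (cases s) auto
      then have i: "i < s" and l: "l < n"
        using c False by (auto simp: l_def i_def less_mult_imp_div_less)
      have e: "c = t + l * s + i" using False by (simp add: l_def i_def)
      have "A *\<^sub>v vec_block t x l = 0\<^sub>v s"
        using R l mat_kernelD[OF A] by blast
      then show ?thesis
        using nfold_mult_index_block[OF A x l i] i block_index_less[OF l i] by (simp add: e)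
    qed
  qed (use nfold_carrier[OF A, of n] in simp)
qed

section \<open>Graver bases and blocks of vectors\<close>

lemma graver_basis_carrier:
  assumes "A \<in> carrier_mat s t" "x \<in> graver_basis A"
  shows "x \<in> mat_kernel A" "x \<in> carrier_vec t" "x \<noteq> 0\<^sub>v t"
  using assms by (auto simp: graver_basis_def mat_kernel_def)

lemma graver_basis_conformal_cases:
  assumes "A \<in> carrier_mat s t" "x \<in> graver_basis A" "y \<in> mat_kernel A" "y \<sqsubseteq>\<^sub>c x"
  shows "y = 0\<^sub>v t \<or> y = x"
  using assms by (auto simp: graver_basis_def)

lemma vec_block_index [simp]: "j < t \<Longrightarrow> vec_block t x l $ j = x $ (l * t + j)"
  by (simp add: vec_block_def)

lemma vec_block_carrier [simp]: "vec_block t x l \<in> carrier_vec t"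
  by (simp add: vec_block_def)

lemma dim_vec_block [simp]: "dim_vec (vec_block t x l) = t"
  by (simp add: vec_block_def)

lemma eq_vec_blockI:
  assumes x: "x \<in> carrier_vec (n * t)" and y: "y \<in> carrier_vec (n * t)"
    and eq: "\<And>l. l < n \<Longrightarrow> vec_block t x l = vec_block t y l"
  shows "x = y"
proof (rule eq_vecI)
  fix c assume "c < dim_vec y"
  then have c: "c < n * t" using y by simp
  then have t: "t > 0" by (cases t) auto
  have "vec_block t x (c div t) $ (c mod t) = vec_block t y (c div t) $ (c mod t)"
    using eq c by (simp add: less_mult_imp_div_less)
  then show "x $ c = y $ c" using t by simp
qed (use x y in simp)

lemma conformal_vec_block:
  assumes x: "x \<in> carrier_vec (n * t)" and y: "y \<in> carrier_vec (n * t)"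
    and le: "y \<sqsubseteq>\<^sub>c x" and l: "l < n"
  shows "vec_block t y l \<sqsubseteq>\<^sub>c vec_block t x l"
  using assms block_index_less[OF l] by (auto simp: conformal_def vec_block_def)

section \<open>Lower bounds from primitive relations\<close>

text \<open>Thus \<open>h\<close> generates the group of all integer relations. The coordinate set
  \<open>J\<close> has arbitrary type so that it can consist of vector indices as well as of edges
  \<open>(c, r)\<close>.\<close>

definition primitive_relation :: "nat \<Rightarrow> (nat \<Rightarrow> nat) \<Rightarrow> (nat \<Rightarrow> 'a \<Rightarrow> int) \<Rightarrow> 'a set \<Rightarrow> bool" where
  "primitive_relation k h C J \<longleftrightarrow> (\<forall>x\<in>J. (\<Sum>i<k. int (h i) * C i x) = 0) \<and>
     (\<forall>g. (\<forall>x\<in>J. (\<Sum>i<k. g i * C i x) = 0) \<longrightarrow> (\<exists>z. \<forall>i<k. g i = z * int (h i)))"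

lemma primitive_relation_imp_multiple:
  assumes "primitive_relation k h C J" "\<And>x. x \<in> J \<Longrightarrow> (\<Sum>i<k. g i * C i x) = 0"
  obtains z where "\<And>i. i < k \<Longrightarrow> g i = z * int (h i)"
  using assms unfolding primitive_relation_def by blast

text \<open>Minimality of the stacked vector: below it, each block is either kept or erased, because
  the \<open>C i\<close> are minimal. Counting the kept copies gives a relation, hence a multiple of
  \<open>h\<close> bounded by \<open>h\<close> itself, so all copies are kept or none is.\<close>

lemma graver_complexity_ge_primitive_relation:
  assumes A: "A \<in> carrier_mat s t"
    and C: "\<And>i. i < k \<Longrightarrow> C i \<in> graver_basis A"
    and h: "\<And>i. i < k \<Longrightarrow> h i > 0" and k: "k > 0"
    and rel: "primitive_relation k h (\<lambda>i j. C i $ j) {..<t}"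
  shows "enat (\<Sum>i<k. h i) \<le> graver_complexity A"
proof -
  define N where "N = (\<Sum>i<k. h i)"
  obtain \<sigma> where \<sigma>: "\<And>l. l < N \<Longrightarrow> \<sigma> l < k"
    and cards: "\<And>i. i < k \<Longrightarrow> card {l \<in> {..<N}. \<sigma> l = i} = h i"
    using obtain_with_fiber_cards[where k=k and h=h] unfolding N_def by metis
  have N: "N \<ge> 1"
    using h[of 0] k member_le_sum[of 0 "{..<k}" h] by (simp add: N_def)
  have Ck: "C i \<in> mat_kernel A" "C i \<in> carrier_vec t" "C i \<noteq> 0\<^sub>v t" if "i < k" for i
    using graver_basis_carrier[OF A C[OF that]] by auto
  define x where "x = vec (N * t) (\<lambda>c. C (\<sigma> (c div t)) $ (c mod t))"
  have x: "x \<in> carrier_vec (N * t)" by (simp add: x_def)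
  have xij: "x $ (l * t + j) = C (\<sigma> l) $ j" if "l < N" "j < t" for l j
    using that block_index_less[OF that] by (simp add: x_def)
  have xb: "vec_block t x l = C (\<sigma> l)" if "l < N" for l
    using Ck(2)[OF \<sigma>[OF that]] that by (intro eq_vecI) (auto simp: xij vec_block_def)
  have fib: "(\<Sum>l\<in>S. C (\<sigma> l) $ j) = (\<Sum>i<k. int (card {l \<in> S. \<sigma> l = i}) * C i $ j)"
    if "S \<subseteq> {..<N}" for S j
    using that \<sigma> by (intro sum_fibers) (auto intro: finite_subset)
  have ker: "x \<in> mat_kernel (nfold A N)"
    unfolding mat_kernel_nfold_iff[OF A]
  proof (intro conjI allI impI x)
    fix j assume j: "j < t"
    have "(\<Sum>l<N. x $ (l * t + j)) = (\<Sum>l<N. C (\<sigma> l) $ j)"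
      using j by (simp add: xij)
    also have "\<dots> = (\<Sum>i<k. int (h i) * C i $ j)"
      using cards by (simp add: fib)
    also have "\<dots> = 0" using rel j by (simp add: primitive_relation_def)
    finally show "(\<Sum>l<N. x $ (l * t + j)) = 0" .
  next
    fix l assume "l < N"
    then show "vec_block t x l \<in> mat_kernel A" using xb Ck(1) \<sigma> by simp
  qed
  have dim: "dim_col (nfold A N) = N * t" using nfold_carrier[OF A, of N] by simp
  have min: "y = x" if y: "y \<in> mat_kernel (nfold A N)" "y \<noteq> 0\<^sub>v (N * t)" "y \<sqsubseteq>\<^sub>c x" for y
  proof -
    have yc: "y \<in> carrier_vec (N * t)" and ysum: "\<And>j. j < t \<Longrightarrow> (\<Sum>l<N. y $ (l * t + j)) = 0"
      and yker: "\<And>l. l < N \<Longrightarrow> vec_block t y l \<in> mat_kernel A"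
      using y(1) unfolding mat_kernel_nfold_iff[OF A] by auto
    have yb: "vec_block t y l = 0\<^sub>v t \<or> vec_block t y l = C (\<sigma> l)" if "l < N" for l
      using graver_basis_conformal_cases[OF A C[OF \<sigma>[OF that]] yker[OF that]]
        conformal_vec_block[OF x yc y(3) that] xb[OF that] by simp
    \<comment> \<open>The positions of the kept blocks; \<open>?g i\<close> below counts the kept
      copies of \<open>C i\<close>.\<close>
    define S where "S = {l \<in> {..<N}. vec_block t y l \<noteq> 0\<^sub>v t}"
    have S: "S \<subseteq> {..<N}" by (auto simp: S_def)
    let ?g = "\<lambda>i. card {l \<in> S. \<sigma> l = i}"
    have yS: "y $ (l * t + j) = (if l \<in> S then C (\<sigma> l) $ j else 0)" if "l < N" "j < t" for l j
    proof -
      have "y $ (l * t + j) = vec_block t y l $ j" using that by simp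
      then show ?thesis
        using yb[OF that(1)] that by (auto simp: S_def simp del: vec_block_index)
    qed
    \<comment> \<open>The blocks of \<open>y\<close> sum to zero, and grouping them by fibre makes
      the counts a relation.\<close>
    have "(\<Sum>i<k. int (?g i) * C i $ j) = 0" if j: "j < t" for j
    proof -
      have "(\<Sum>i<k. int (?g i) * C i $ j) = (\<Sum>l\<in>S. C (\<sigma> l) $ j)"
        using fib[OF S] by simp
      also have "\<dots> = (\<Sum>l<N. if l \<in> S then C (\<sigma> l) $ j else 0)"
        using S by (simp add: sum.If_cases Int_absorb1)
      also have "\<dots> = (\<Sum>l<N. y $ (l * t + j))"
        using j by (simp add: yS)
      finally show ?thesis using ysum[OF j] by simp
    qed
    then obtain z where z: "\<And>i. i < k \<Longrightarrow> int (?g i) = z * int (h i)"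
      using primitive_relation_imp_multiple[OF rel, of "\<lambda>i. int (?g i)"] by auto
    have "S \<noteq> {}"
    proof
      assume "S = {}"
      then have "y = 0\<^sub>v (N * t)"
        by (intro eq_vec_blockI[OF yc]) (auto simp: S_def vec_block_def block_index_less)
      with y(2) show False by simp
    qed
    then obtain l where l: "l \<in> S" by blast
    then have lk: "\<sigma> l < k" using \<sigma> S by auto
    have "?g (\<sigma> l) > 0"
      using l finite_subset[OF S] by (auto simp: card_gt_0_iff)
    then have "z * int (h (\<sigma> l)) > 0" using z[OF lk] by simp
    then have z1: "z \<ge> 1" using h[OF lk] by (simp add: zero_less_mult_iff)
    \<comment> \<open>As \<open>z\<close> is at least 1, at least \<open>h i\<close> copies of
      \<open>C i\<close> are kept, and there are only \<open>h i\<close> of them.\<close>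
    have full: "{l \<in> S. \<sigma> l = i} = {l \<in> {..<N}. \<sigma> l = i}" if i: "i < k" for i
    proof (rule card_seteq)
      have "int (h i) \<le> z * int (h i)" using z1 by (simp add: mult_le_cancel_right1)
      then show "card {l \<in> {..<N}. \<sigma> l = i} \<le> ?g i"
        using z[OF i] cards[OF i] by simp
    qed (use S in auto)
    show "y = x"
    proof (rule eq_vec_blockI[OF yc x])
      fix l assume l: "l < N"
      then have "l \<in> S" using full[OF \<sigma>[OF l]] by auto
      then show "vec_block t y l = vec_block t x l"
        using yb[OF l] xb[OF l] by (auto simp: S_def)
    qed
  qed
  have "x \<noteq> 0\<^sub>v (N * t)"
  proof
    assume x0: "x = 0\<^sub>v (N * t)"
    have "C (\<sigma> 0) = 0\<^sub>v t"
      using xb[of 0] N Ck(2)[of "\<sigma> 0"] \<sigma>[of 0] block_index_less[of 0 N _ t]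
      by (intro eq_vecI) (auto simp: x0 xij[of 0, symmetric])
    then show False using Ck(3)[of "\<sigma> 0"] \<sigma>[of 0] N by simp
  qed
  then have "x \<in> graver_basis (nfold A N)"
    using ker min by (auto simp: graver_basis_def dim)
  moreover have "vec_type t N x = N"
  proof -
    have "{i. i < N \<and> vec_block t x i \<noteq> 0\<^sub>v t} = {..<N}"
      using xb Ck(3) \<sigma> by auto
    then show ?thesis by (simp add: vec_type_def)
  qed
  ultimately have "enat N \<in> {enat (vec_type (dim_col A) n x) | n x. n \<ge> 1 \<and> x \<in> graver_basis (nfold A n)}"
    using N A by force
  then show ?thesis
    unfolding graver_complexity_def N_def by (intro Sup_upper) blast
qed

section \<open>The row (1,1,1) and its n-fold products\<close>

lemma row_111_carrier: "row_111 \<in> carrier_mat 1 3"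
  by (simp add: row_111_def mat_of_rows_list_def)

lemma mat_kernel_row_111_iff:
  "v \<in> mat_kernel row_111 \<longleftrightarrow> v \<in> carrier_vec 3 \<and> (\<Sum>r<3. v $ r) = 0"
proof -
  have "(row_111 *\<^sub>v v = 0\<^sub>v 1) \<longleftrightarrow> (\<Sum>r<3. v $ r) = 0" if v: "v \<in> carrier_vec 3"
  proof -
    have "(row_111 *\<^sub>v v) $ 0 = (\<Sum>r<3. row_111 $$ (0, r) * v $ r)"
      by (rule mult_mat_vec_index_sum[OF row_111_carrier v]) simp
    also have "\<dots> = (\<Sum>r<3. v $ r)"
      by (simp add: row_111_def mat_of_rows_list_def eval_nat_numeral)
    finally have "(row_111 *\<^sub>v v) $ 0 = (\<Sum>r<3. v $ r)" .
    moreover have "row_111 *\<^sub>v v = 0\<^sub>v 1 \<longleftrightarrow> (row_111 *\<^sub>v v) $ 0 = 0"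
      using row_111_carrier by (subst vec_eq_iff) auto
    ultimately show ?thesis by simp
  qed
  then show ?thesis using mat_kernel[OF row_111_carrier] by auto
qed

lemma nfold_row_111_carrier: "nfold row_111 m \<in> carrier_mat (3 + m) (m * 3)"
  using nfold_carrier[OF row_111_carrier, of m] by simp

lemma mat_kernel_nfold_row_111_iff:
  "x \<in> mat_kernel (nfold row_111 m) \<longleftrightarrow> x \<in> carrier_vec (m * 3) \<and>
    (\<forall>r<3. (\<Sum>c<m. x $ (c * 3 + r)) = 0) \<and> (\<forall>c<m. (\<Sum>r<3. x $ (c * 3 + r)) = 0)"
  by (simp add: mat_kernel_nfold_iff[OF row_111_carrier] mat_kernel_row_111_iff)

section \<open>Edge tables of K_{3,m} and hexagons\<close>

text \<open>A table gives a value to each edge of K_{3,m}: \<open>c\<close> is the vertex on the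
  side of size \<open>m\<close>, \<open>r\<close> the one on the side of size 3. Block
  \<open>c\<close> of the vector is column \<open>c\<close> of the table.\<close>

definition table_vec :: "nat \<Rightarrow> (nat \<Rightarrow> nat \<Rightarrow> int) \<Rightarrow> int vec" where
  "table_vec m C = vec (m * 3) (\<lambda>x. C (x div 3) (x mod 3))"

lemma table_vec_carrier [simp]: "table_vec m C \<in> carrier_vec (m * 3)"
  by (simp add: table_vec_def)

lemma table_vec_index [simp]: "c < m \<Longrightarrow> r < 3 \<Longrightarrow> table_vec m C $ (c * 3 + r) = C c r"
  using block_index_less[of c m r 3] by (simp add: table_vec_def)

text \<open>The cycle through the edges \<open>(p,i), (p,j), (q,j), (q,k), (s,k), (s,i)\<close>, with alternating signs;
  the first argument is the vertex on the side of size \<open>m\<close>.\<close>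

definition hexagon :: "nat \<Rightarrow> nat \<Rightarrow> nat \<Rightarrow> nat \<Rightarrow> nat \<Rightarrow> nat \<Rightarrow> nat \<Rightarrow> nat \<Rightarrow> int" where
  "hexagon p q s i j k c r =
     (if c = p then of_bool (r = i) - of_bool (r = j) else 0) +
     (if c = q then of_bool (r = j) - of_bool (r = k) else 0) +
     (if c = s then of_bool (r = k) - of_bool (r = i) else 0)"

definition hexagons :: "nat \<Rightarrow> (nat \<Rightarrow> nat \<Rightarrow> int) set" where
  "hexagons m = {hexagon p q s i j k | p q s i j k.
     distinct [p, q, s] \<and> {p, q, s} \<subseteq> {..<m} \<and> distinct [i, j, k] \<and> {i, j, k} \<subseteq> {..<3}}"

lemma hexagon_in_hexagons:
  assumes "distinct [p, q, s]" "{p, q, s} \<subseteq> {..<m}" "distinct [i, j, k]" "{i, j, k} \<subseteq> {..<3}"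
  shows "hexagon p q s i j k \<in> hexagons m"
  using assms unfolding hexagons_def by blast

lemma hexagons_mono: "m \<le> m' \<Longrightarrow> hexagons m \<subseteq> hexagons m'"
  unfolding hexagons_def by fastforce

lemma hexagons_outside: "C \<in> hexagons m \<Longrightarrow> m \<le> c \<Longrightarrow> C c r = 0"
  by (force simp: hexagons_def hexagon_def)

text \<open>A kernel vector supported on a cycle is determined by its value on one edge, hence a
  multiple of the alternating vector. Conformality leaves only the factors 0 and 1.\<close>

lemma hexagon_in_graver_basis:
  assumes pqs: "distinct [p, q, s]" "{p, q, s} \<subseteq> {..<m}"
    and ijk': "distinct [i, j, k]" "{i, j, k} \<subseteq> {..<3}"
  shows "table_vec m (hexagon p q s i j k) \<in> graver_basis (nfold row_111 m)"
proof -
  \<comment> \<open>A hexagon uses all three vertices of the small side, so row sums involve just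
    \<open>i\<close>, \<open>j\<close>, \<open>k\<close>.\<close>
  have "{i, j, k} = {..<3}"
    using ijk' by (intro card_seteq) auto
  note ijk = ijk'(1) this
  let ?H = "hexagon p q s i j k"
  have lt: "i < 3" "j < 3" "k < 3" "p < m" "q < m" "s < m" using ijk pqs by auto
  have rows: "(\<Sum>r<3. f r) = f i + f j + f k" for f :: "nat \<Rightarrow> int"
    using ijk by (simp flip: ijk(2))
  have cols: "(\<Sum>c<m. f c) = f p + f q + f s"
    if "\<And>c. c < m \<Longrightarrow> c \<notin> {p, q, s} \<Longrightarrow> f c = 0" for f :: "nat \<Rightarrow> int"
  proof -
    have "(\<Sum>c<m. f c) = (\<Sum>c\<in>{p, q, s}. f c)"
      using pqs(2) that by (intro sum.mono_neutral_right) auto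
    then show ?thesis using pqs(1) by simp
  qed
  have ker: "table_vec m ?H \<in> mat_kernel (nfold row_111 m)"
    unfolding mat_kernel_nfold_row_111_iff
  proof (intro conjI allI impI table_vec_carrier)
    fix r :: nat assume "r < 3"
    then have "(\<Sum>c<m. table_vec m ?H $ (c * 3 + r)) = (\<Sum>c<m. ?H c r)" by simp
    also have "\<dots> = ?H p r + ?H q r + ?H s r"
      by (rule cols) (simp add: hexagon_def)
    also have "\<dots> = 0" using pqs(1) by (simp add: hexagon_def)
    finally show "(\<Sum>c<m. table_vec m ?H $ (c * 3 + r)) = 0" .
  next
    fix c assume "c < m"
    then have "(\<Sum>r<3. table_vec m ?H $ (c * 3 + r)) = (\<Sum>r<3. ?H c r)" by simp
    also have "\<dots> = 0" using ijk(1) by (simp add: rows hexagon_def)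
    finally show "(\<Sum>r<3. table_vec m ?H $ (c * 3 + r)) = 0" .
  qed
  have nz: "table_vec m ?H \<noteq> 0\<^sub>v (m * 3)"
  proof
    assume "table_vec m ?H = 0\<^sub>v (m * 3)"
    then have "table_vec m ?H $ (p * 3 + i) = 0\<^sub>v (m * 3) $ (p * 3 + i)" by simp
    then show False
      using lt pqs(1) ijk(1) block_index_less[of p m i 3] by (simp add: hexagon_def)
  qed
  have min: "y = table_vec m ?H"
    if y: "y \<in> mat_kernel (nfold row_111 m)" "y \<noteq> 0\<^sub>v (m * 3)" "y \<sqsubseteq>\<^sub>c table_vec m ?H" for y
  proof -
    define Y where "Y c r = y $ (c * 3 + r)" for c r
    have yc: "y \<in> carrier_vec (m * 3)"
      and Yr: "\<And>r. r < 3 \<Longrightarrow> (\<Sum>c<m. Y c r) = 0" and Yc: "\<And>c. c < m \<Longrightarrow> (\<Sum>r<3. Y c r) = 0"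
      using y(1) by (auto simp: mat_kernel_nfold_row_111_iff Y_def)
    have le: "\<bar>Y c r\<bar> \<le> \<bar>?H c r\<bar> \<and> Y c r * ?H c r \<ge> 0" if "c < m" "r < 3" for c r
    proof -
      have "c * 3 + r < dim_vec y" using block_index_less[OF that] yc by simp
      then have "\<bar>y $ (c * 3 + r)\<bar> \<le> \<bar>table_vec m ?H $ (c * 3 + r)\<bar> \<and>
          y $ (c * 3 + r) * table_vec m ?H $ (c * 3 + r) \<ge> 0"
        using y(3) unfolding conformal_def by blast
      then show ?thesis using that by (simp add: Y_def)
    qed
    define \<alpha> where "\<alpha> = Y p i"
    have out: "Y c r = 0" if "c < m" "r < 3" "c \<notin> {p, q, s}" for c r
      using le[OF that(1,2)] that(3) by (simp add: hexagon_def)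
    have Yrow: "Y p r + Y q r + Y s r = 0" if "r < 3" for r
      using Yr[OF that] cols[of "\<lambda>c. Y c r"] out that by simp
    have zero: "Y p k = 0" "Y q i = 0" "Y s j = 0"
      using le[of p k] le[of q i] le[of s j] lt pqs(1) ijk(1) by (auto simp: hexagon_def)
    \<comment> \<open>Walking around the cycle from the edge \<open>(p, i)\<close>: every vertex on
      it meets two cycle edges, whose values must cancel, so \<alpha> propagates with alternating
      sign.\<close>
    have edges: "Y p j = -\<alpha>" "Y q j = \<alpha>" "Y q k = -\<alpha>" "Y s k = \<alpha>" "Y s i = -\<alpha>"
      using zero Yrow[of i] Yrow[of j] Yrow[of k] Yc[of p] Yc[of q] lt
      by (auto simp: rows \<alpha>_def)
    have H: "?H p i = 1" "?H p j = -1" "?H p k = 0" "?H q i = 0" "?H q j = 1" "?H q k = -1"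
      "?H s i = -1" "?H s j = 0" "?H s k = 1"
      using pqs(1) ijk(1) by (simp_all add: hexagon_def)
    have YH: "Y c r = \<alpha> * ?H c r" if "c < m" "r < 3" for c r
    proof (cases "c \<in> {p, q, s}")
      case True
      moreover have "r \<in> {i, j, k}" using that(2) ijk(2) by simp
      ultimately show ?thesis
        using zero edges H by (elim insertE) (simp_all add: \<alpha>_def)
    next
      case False
      then show ?thesis using out[OF that] by (simp add: hexagon_def)
    qed
    \<comment> \<open>Conformality at the single edge \<open>(p, i)\<close>, where the hexagon has
      value 1.\<close>
    have "0 \<le> \<alpha>" "\<alpha> \<le> 1"
      using le[of p i] lt H(1) by (auto simp: \<alpha>_def)
    moreover have "\<alpha> \<noteq> 0"
    proof
      assume "\<alpha> = 0"
      then have "y = 0\<^sub>v (m * 3)"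
        using YH block_index_less[of _ m _ 3]
        by (intro eq_vec_blockI[OF yc]) (auto simp: vec_block_def Y_def intro!: eq_vecI)
      with y(2) show False by simp
    qed
    ultimately have "\<alpha> = 1" by linarith
    then show ?thesis
      using YH by (intro eq_vec_blockI[OF yc]) (auto simp: Y_def \<open>\<alpha> = 1\<close> intro!: eq_vecI)
  qed
  show ?thesis
    using ker nz min nfold_row_111_carrier[of m] by (auto simp: graver_basis_def)
qed

text \<open>Passes from relations between tables, checked edge by edge, to relations between the
  flattened vectors.\<close>

lemma graver_complexity_ge_hexagons:
  assumes "\<And>i. i < k \<Longrightarrow> C i \<in> hexagons m" "\<And>i. i < k \<Longrightarrow> h i > 0" "k > 0"
    and rel: "primitive_relation k h (\<lambda>i (c, r). C i c r) ({..<m} \<times> {..<3})"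
  shows "enat (\<Sum>i<k. h i) \<le> graver_complexity (nfold row_111 m)"
proof (rule graver_complexity_ge_primitive_relation[OF nfold_row_111_carrier])
  show "table_vec m (C i) \<in> graver_basis (nfold row_111 m)" if "i < k" for i
    using assms(1)[OF that] hexagon_in_graver_basis by (auto simp: hexagons_def)
  \<comment> \<open>With \<open>g\<close> arbitrary, this equivalence transfers both clauses of
    \<open>primitive_relation\<close>.\<close>
  have "(\<forall>x\<in>{..<m} \<times> {..<3}. (\<Sum>i<k. g i * (case x of (c, r) \<Rightarrow> C i c r)) = 0) \<longleftrightarrow>
      (\<forall>x\<in>{..<m * 3}. (\<Sum>i<k. g i * table_vec m (C i) $ x) = 0)" for g
  proof (intro iffI ballI)
    fix x assume "\<forall>x\<in>{..<m} \<times> {..<3}. (\<Sum>i<k. g i * (case x of (c, r) \<Rightarrow> C i c r)) = 0"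
      and "x \<in> {..<m * 3}"
    then show "(\<Sum>i<k. g i * table_vec m (C i) $ x) = 0"
      by (simp add: table_vec_def less_mult_imp_div_less)
  next
    fix x :: "nat \<times> nat"
    assume *: "\<forall>x\<in>{..<m * 3}. (\<Sum>i<k. g i * table_vec m (C i) $ x) = 0"
      and "x \<in> {..<m} \<times> {..<3}"
    then obtain c r where "x = (c, r)" "c < m" "r < 3" by auto
    then show "(\<Sum>i<k. g i * (case x of (c, r) \<Rightarrow> C i c r)) = 0"
      using *[rule_format, of "c * 3 + r"] block_index_less[of c m r 3] by simp
  qed
  then show "primitive_relation k h (\<lambda>i j. table_vec m (C i) $ j) {..<m * 3}"
    using rel unfolding primitive_relation_def by simp
qed (use assms in auto)

section \<open>The step from m to m + 1 columns\<close>

text \<open>The distinguished hexagon sits at the last index, on columns 0, 1 and the last one. Of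
  its three replacements, those for columns 0 and 1 go to \<open>k\<close> and \<open>k + 1\<close>;
  the one for column \<open>m - 1\<close> is again of the distinguished shape and becomes the new
  last hexagon.\<close>

lemma primitive_relation_extend:
  fixes m k :: nat
  assumes m: "m > 2" and C: "\<And>i. i < k \<Longrightarrow> C i \<in> hexagons m"
    and rel: "primitive_relation (Suc k) (h(k := 7))
      (\<lambda>i (c, r). (C(k := hexagon 0 1 (m - 1) 0 1 2)) i c r) ({..<m} \<times> {..<3})"
  defines "C' \<equiv> C(k := hexagon m 1 (m - 1) 0 1 2, Suc k := hexagon 0 m (m - 1) 0 1 2)"
    and "h' \<equiv> \<lambda>i. if i < k then 2 * h i else 7"
  shows "primitive_relation (Suc (k + 2)) (h'(k + 2 := 7))
    (\<lambda>i (c, r). (C'(k + 2 := hexagon 0 1 m 0 1 2)) i c r) ({..<Suc m} \<times> {..<3})"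
proof -
  let ?L = "hexagon 0 1 (m - 1) 0 1 2" and ?D1 = "hexagon m 1 (m - 1) 0 1 2"
    and ?D2 = "hexagon 0 m (m - 1) 0 1 2" and ?D3 = "hexagon 0 1 m 0 1 2"
  have ne: "m \<noteq> m - Suc 0" using m by simp
  have old: "(\<Sum>i<Suc k. g i * (C(k := ?L)) i c r) = (\<Sum>i<k. g i * C i c r) + g k * ?L c r"
    for g :: "nat \<Rightarrow> int" and c r
    by simp
  have new: "(\<Sum>i<Suc (k + 2). g i * (C'(k + 2 := ?D3)) i c r) =
      (\<Sum>i<k. g i * C i c r) + g k * ?D1 c r + g (k + 1) * ?D2 c r + g (k + 2) * ?D3 c r"
    for g :: "nat \<Rightarrow> int" and c r
    by (simp add: C'_def)
  \<comment> \<open>Each column of \<open>?L\<close> survives unchanged in exactly two of the three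
    replacements.\<close>
  have split: "?D1 c r + ?D2 c r + ?D3 c r = 2 * ?L c r" if "c < m" "r < 3" for c r
    using that m by (auto simp: hexagon_def)
  have outside: "(\<Sum>i<k. g i * C i m r) = 0" for g :: "nat \<Rightarrow> int" and r
    using hexagons_outside[OF C, of _ m r] by (intro sum.neutral) simp
  have rel_old: "(\<Sum>i<k. int (h i) * C i c r) + 7 * ?L c r = 0" if "c < m" "r < 3" for c r
    using rel that old[of "\<lambda>i. int ((h(k := 7)) i)" c r] unfolding primitive_relation_def by auto
  show ?thesis
    unfolding primitive_relation_def
  proof (intro conjI ballI allI impI)
    fix x :: "nat \<times> nat" assume "x \<in> {..<Suc m} \<times> {..<3}"
    then obtain c r where x: "x = (c, r)" "c \<le> m" "r < 3" by auto
    let ?g = "\<lambda>i. int ((h'(k + 2 := 7)) i)"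
    have h': "(\<Sum>i<k. ?g i * C i c r) = 2 * (\<Sum>i<k. int (h i) * C i c r)"
      by (simp add: h'_def sum_distrib_left mult.assoc)
    have "(\<Sum>i<Suc (k + 2). ?g i * (C'(k + 2 := ?D3)) i c r) =
        2 * (\<Sum>i<k. int (h i) * C i c r) + 7 * (?D1 c r + ?D2 c r + ?D3 c r)"
      unfolding new h' by (simp add: h'_def)
    also have "\<dots> = 0"
    \<comment> \<open>In the new column the old hexagons vanish, and the three replacements
      contribute e0 - e1, e1 - e2 and e2 - e0, whose sum is zero.\<close>
    proof (cases "c = m")
      case True
      then show ?thesis using m outside by (auto simp: hexagon_def)
    next
      case False
      then show ?thesis using split[of c r] rel_old[of c r] x by simp
    qed
    finally show "(\<Sum>i<Suc (k + 2). ?g i * (case x of (c, r) \<Rightarrow> (C'(k + 2 := ?D3)) i c r)) = 0"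
      by (simp only: x prod.case)
  next
    fix g :: "nat \<Rightarrow> int"
    assume "\<forall>x\<in>{..<Suc m} \<times> {..<3}. (\<Sum>i<Suc (k + 2). g i *
      (case x of (c, r) \<Rightarrow> (C'(k + 2 := ?D3)) i c r)) = 0"
    then have g: "(\<Sum>i<k. g i * C i c r) + g k * ?D1 c r + g (k + 1) * ?D2 c r + g (k + 2) * ?D3 c r = 0"
      if "c \<le> m" "r < 3" for c r
      using that new[of g c r] by auto
    \<comment> \<open>The new column reads off \<open>g k = g (k + 2)\<close> in row 0 and
      \<open>g (k + 1) = g k\<close> in row 1.\<close>
    have eq: "g (k + 1) = g k" "g (k + 2) = g k"
      using g[of m 0] g[of m 1] m ne by (auto simp: outside hexagon_def)
    \<comment> \<open>With equal coefficients the three replacements merge into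
      \<open>2 * g k\<close> copies of \<open>?L\<close>, which leaves a relation between the old
      hexagons.\<close>
    have "(\<Sum>i<Suc k. (g(k := 2 * g k)) i * (case x of (c, r) \<Rightarrow> (C(k := ?L)) i c r)) = 0"
      if xJ: "x \<in> {..<m} \<times> {..<3}" for x
    proof -
      obtain c r where x: "x = (c, r)" "c < m" "r < 3" using xJ by auto
      have "(\<Sum>i<k. g i * C i c r) + g k * (?D1 c r + ?D2 c r + ?D3 c r) = 0"
        using g[of c r, unfolded eq] x by (simp add: distrib_left)
      then show ?thesis using split[OF x(2,3)] x(1) by simp
    qed
    then obtain z where z: "\<And>i. i < Suc k \<Longrightarrow> (g(k := 2 * g k)) i = z * int ((h(k := 7)) i)"
      using primitive_relation_imp_multiple[OF rel, of "g(k := 2 * g k)"] by blast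
    \<comment> \<open>Since 7 is odd, \<open>z\<close> is even; its half \<open>w\<close> is the
      multiplier for the doubled weights.\<close>
    have "2 * g k = z * 7" using z[of k] by simp
    moreover from this have "even z" by presburger
    then obtain w where "z = 2 * w" by blast
    ultimately have w: "z = 2 * w" "g k = w * 7" by simp_all
    have "g i = w * int ((h'(k + 2 := 7)) i)" if "i < Suc (k + 2)" for i
    proof -
      have "i < k \<or> i = k \<or> i = k + 1 \<or> i = k + 2" using that by linarith
      then show ?thesis
        using z[of i] w eq by (elim disjE) (auto simp: h'_def)
    qed
    then show "\<exists>z. \<forall>i<Suc (k + 2). g i = z * int ((h'(k + 2 := 7)) i)" by blast
  qed
qed

section \<open>The base case m = 4 and the induction\<close>

text \<open>The cycle space of K_{3,4} has dimension 6, so seven hexagons are always dependent;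
  these seven span it, so their relation is unique up to scaling. The seventh is fixed by the shape
  needed for the induction, and its weight 7 is not part of the sum 20.\<close>

lemma exists_hexagon_relation_4:
  "\<exists>C h. (\<forall>i<6. C i \<in> hexagons 4 \<and> h i > 0) \<and>
    primitive_relation (Suc 6) (h(6 := 7)) (\<lambda>i (c, r). (C(6 := hexagon 0 1 3 0 1 2)) i c r)
      ({..<4} \<times> {..<3}) \<and>
    (\<Sum>i<6. h i) = 20"
proof (intro exI conjI)
  let ?C = "(!) [hexagon 0 1 3 1 0 2, hexagon 2 1 3 2 1 0, hexagon 0 1 2 1 2 0, hexagon 0 2 1 1 2 0,
      hexagon 2 1 3 1 2 0, hexagon 0 1 3 2 0 1]"
    and ?h = "(!) [1, 2, 3, 3, 5, 6 :: nat]"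
  have all6: "(\<forall>i<6. P i) \<longleftrightarrow> P 0 \<and> P 1 \<and> P 2 \<and> P 3 \<and> P 4 \<and> P (5::nat)" for P
    by (simp add: eval_nat_numeral All_less_Suc conj_ac)
  have sum6: "(\<Sum>i<6. f i) = f 0 + f 1 + f 2 + f 3 + f 4 + f 5" for f :: "nat \<Rightarrow> 'b::comm_monoid_add"
    by (simp add: eval_nat_numeral)
  have "(\<forall>x\<in>{..<4} \<times> {..<3}. P x) \<longleftrightarrow> (\<forall>c<4. \<forall>r<3. P (c, r))" for P :: "nat \<times> nat \<Rightarrow> bool"
    by auto
  then have cells: "(\<forall>x\<in>{..<4} \<times> {..<3}. P x) \<longleftrightarrow>
      P (0, 0) \<and> P (0, 1) \<and> P (0, 2) \<and> P (1, 0) \<and> P (1, 1) \<and> P (1, 2) \<and>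
      P (2, 0) \<and> P (2, 1) \<and> P (2, 2) \<and> P (3, 0) \<and> P (3, 1) \<and> P (3::nat, 2::nat)" for P
    by (simp add: eval_nat_numeral All_less_Suc conj_ac)
  show "\<forall>i<6. ?C i \<in> hexagons 4 \<and> ?h i > 0"
    unfolding all6 by (simp add: hexagon_in_hexagons)
  show "(\<Sum>i<6. ?h i) = 20"
    by (simp add: sum6)
  \<comment> \<open>Solving the twelve edge equations expresses all coefficients through
    \<open>g 0\<close>. Its weight is 1, so \<open>g 0\<close> itself is the integer
    multiplier.\<close>
  have rel: "(\<forall>x\<in>{..<4} \<times> {..<3}. (\<Sum>i<Suc 6. g i *
        (case x of (c, r) \<Rightarrow> (?C(6 := hexagon 0 1 3 0 1 2)) i c r)) = 0) \<longleftrightarrow>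
      g 1 = 2 * g 0 \<and> g 2 = 3 * g 0 \<and> g 3 = 3 * g 0 \<and> g 4 = 5 * g 0 \<and> g 5 = 6 * g 0 \<and> g 6 = 7 * g 0"
    for g :: "nat \<Rightarrow> int"
    unfolding cells sum.lessThan_Suc sum6 by (simp add: hexagon_def) (intro iffI conjI; linarith)
  show "primitive_relation (Suc 6) (?h(6 := 7)) (\<lambda>i (c, r). (?C(6 := hexagon 0 1 3 0 1 2)) i c r)
      ({..<4} \<times> {..<3})"
    unfolding primitive_relation_def rel All_less_Suc all6 by auto
qed

text \<open>The sum omits the last weight 7. Its step is doubling plus 14, from the two replacements
  that join the list, so adding 14 turns the recursion into plain doubling, starting from 20 + 14 =
  17 * 2.\<close>

lemma exists_hexagon_relation:
  assumes "m > 3"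
  shows "\<exists>k C h. (\<forall>i<k. C i \<in> hexagons m \<and> h i > 0) \<and>
    primitive_relation (Suc k) (h(k := 7))
      (\<lambda>i (c, r). (C(k := hexagon 0 1 (m - 1) 0 1 2)) i c r) ({..<m} \<times> {..<3}) \<and>
    (\<Sum>i<k. h i) + 14 = 17 * 2 ^ (m - 3)"
proof -
  from assms have "4 \<le> m" by simp
  then show ?thesis
  proof (induction m rule: nat_induct_at_least)
    case base
    obtain C h where "\<forall>i<6. C i \<in> hexagons 4 \<and> h i > (0 :: nat)" "(\<Sum>i<6. h i) = 20"
      "primitive_relation (Suc 6) (h(6 := 7)) (\<lambda>i (c, r). (C(6 := hexagon 0 1 3 0 1 2)) i c r)
        ({..<4} \<times> {..<3})"
      using exists_hexagon_relation_4 by blast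
    then show ?case
      by (intro exI[of _ 6] exI[of _ C] exI[of _ h]) (simp del: fun_upd_apply)
  next
    case (Suc m)
    then have m: "m > 3" by simp
    from Suc.IH obtain k C h where C: "\<And>i. i < k \<Longrightarrow> C i \<in> hexagons m" and h: "\<And>i. i < k \<Longrightarrow> h i > 0"
      and rel: "primitive_relation (Suc k) (h(k := 7))
        (\<lambda>i (c, r). (C(k := hexagon 0 1 (m - 1) 0 1 2)) i c r) ({..<m} \<times> {..<3})"
      and S: "(\<Sum>i<k. h i) + 14 = 17 * 2 ^ (m - 3)"
      by blast
    let ?D1 = "hexagon m 1 (m - 1) 0 1 2" and ?D2 = "hexagon 0 m (m - 1) 0 1 2"
    let ?C = "C(k := ?D1, Suc k := ?D2)" and ?h = "\<lambda>i. if i < k then 2 * h i else 7"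
    have "?D1 \<in> hexagons (Suc m)" "?D2 \<in> hexagons (Suc m)"
      using m by (auto intro!: hexagon_in_hexagons)
    then have "\<forall>i<k + 2. ?C i \<in> hexagons (Suc m) \<and> ?h i > 0"
      using C h hexagons_mono[of m "Suc m"] by (auto simp: less_Suc_eq)
    moreover have "primitive_relation (Suc (k + 2)) (?h(k + 2 := 7))
        (\<lambda>i (c, r). (?C(k + 2 := hexagon 0 1 (Suc m - 1) 0 1 2)) i c r) ({..<Suc m} \<times> {..<3})"
      using primitive_relation_extend[OF _ C rel] m by simp
    moreover have "(\<Sum>i<k + 2. ?h i) + 14 = 17 * 2 ^ (Suc m - 3)"
    proof -
      have "Suc m - 3 = Suc (m - 3)" using m by simp
      then show ?thesis using S by (simp add: sum_distrib_left[symmetric])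
    qed
    ultimately show ?case
      by (intro exI[of _ "k + 2"] exI[of _ ?C] exI[of _ ?h] conjI)
  qed
qed

theorem theorem1p4:
  fixes m :: nat
  assumes "m > 3"
  shows "graver_complexity (nfold row_111 m) \<ge> enat (17 * 2 ^ (m - 3) - 7)"
proof -
  obtain k C h where C: "\<And>i. i < k \<Longrightarrow> C i \<in> hexagons m" and h: "\<And>i. i < k \<Longrightarrow> h i > 0"
    and rel: "primitive_relation (Suc k) (h(k := 7))
      (\<lambda>i (c, r). (C(k := hexagon 0 1 (m - 1) 0 1 2)) i c r) ({..<m} \<times> {..<3})"
    and S: "(\<Sum>i<k. h i) + 14 = 17 * 2 ^ (m - 3)"
    using exists_hexagon_relation[OF assms] by blast
  have "hexagon 0 1 (m - 1) 0 1 2 \<in> hexagons m"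
    using assms by (auto intro!: hexagon_in_hexagons)
  then have "enat (\<Sum>i<Suc k. (h(k := 7)) i) \<le> graver_complexity (nfold row_111 m)"
    using C h by (intro graver_complexity_ge_hexagons[OF _ _ _ rel]) (auto simp: less_Suc_eq)
  \<comment> \<open>Including the last weight 7 reduces the deficit from 14 to 7.\<close>
  moreover have "(\<Sum>i<Suc k. (h(k := 7)) i) = 17 * 2 ^ (m - 3) - 7"
    using S by simp
  ultimately show ?thesis by simp
qed

end
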